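(* Let $d \geq 2$, let $\mathbb{F}$ be a fixed field, and let $c_d$ be the unique positive solution of $g_d(x)=d+1$, where $g_d(x)=(d+1)(x+1)e^{-x}+x(1-e^{-x})^{d+1}$. Then for every fixed $c>c_d$, $$\lim_{n\to\infty}\Pr\big[Y\in Y_d(n,\tfrac{c}{n}) : H_d(Y;\mathbb{F})\neq 0\big]=1.$$
   Context: $\Delta_{n-1}$ denotes the $(n-1)$-dimensional simplex on vertex set $[n]$, and $\Delta_{n-1}^{(i)}$ its $i$-dimensional skeleton. For $d\ge 2$ and $0\le p\le 1$, $Y_d(n,p)$ is the probability space of simplicial complexes $Y$ with $\Delta_{n-1}^{(d-1)}\subset Y\subset \Delta_{n-1}^{(d)}$, in which each $d$-simplex of $\Delta_{n-1}$ is included independently with probability $p$ (i.e. $\Pr(Y)=p^{f_d(Y)}(1-p)^{\binom{n}{d+1}-f_d(Y)}$, where $f_d(Y)$ is the number of $d$-simplices of $Y$). $H_d(Y;\mathbb{F})$ is the $d$-th homology group of $Y$ with coefficients in $\mathbb{F}$. *)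

theory Defs
  imports Complex_Main
begin

definition faces :: "nat set set \<Rightarrow> nat \<Rightarrow> nat set set" where
  "faces K k = {\<sigma> \<in> K. card \<sigma> = Suc k}"

text \<open>Simplicial k-chains with coefficients in a field: functions on the k-faces
(each face oriented by the increasing order of its vertices).\<close>

definition chains :: "nat set set \<Rightarrow> nat \<Rightarrow> (nat set \<Rightarrow> 'a::field) set" where
  "chains K k = {c. \<forall>\<sigma>. \<sigma> \<notin> faces K k \<longrightarrow> c \<sigma> = 0}"

text \<open>Boundary map from k-chains to (k-1)-chains:
  boundary of [v_0,...,v_k] is the sum of (-1)^i [v_0,..,v_i omitted,..,v_k].\<close>

definition bdry :: "nat set set \<Rightarrow> nat \<Rightarrow> (nat set \<Rightarrow> 'a::field) \<Rightarrow> nat set \<Rightarrow> 'a" where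
  "bdry K k c \<tau> =
     (if card \<tau> = k \<and> finite \<tau> then
        (\<Sum>v \<in> {v. v \<notin> \<tau> \<and> insert v \<tau> \<in> faces K k}.
            (-1) ^ card {u \<in> \<tau>. u < v} * c (insert v \<tau>))
      else 0)"

definition cycles :: "nat set set \<Rightarrow> nat \<Rightarrow> (nat set \<Rightarrow> 'a::field) set" where
  "cycles K k = {c \<in> chains K k. bdry K k c = (\<lambda>_. 0)}"

definition boundaries :: "nat set set \<Rightarrow> nat \<Rightarrow> (nat set \<Rightarrow> 'a::field) set" where
  "boundaries K k = bdry K (Suc k) ` chains K (Suc k)"

text \<open>H_k(K;F) \<noteq> 0 (for k \<ge> 1): there is a k-cycle that is not a k-boundary.\<close>

definition homology_nonzero :: "'a::field itself \<Rightarrow> nat set set \<Rightarrow> nat \<Rightarrow> bool" where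
  "homology_nonzero _ K k = (\<exists>z::nat set \<Rightarrow> 'a. z \<in> cycles K k \<and> z \<notin> boundaries K k)"

definition dsimplices :: "nat \<Rightarrow> nat \<Rightarrow> nat set set" where
  "dsimplices n d = {\<sigma>. \<sigma> \<subseteq> {..<n} \<and> card \<sigma> = Suc d}"

definition Ycomplex :: "nat \<Rightarrow> nat \<Rightarrow> nat set set \<Rightarrow> nat set set" where
  "Ycomplex n d S = {\<sigma>. \<sigma> \<subseteq> {..<n} \<and> card \<sigma> \<le> d} \<union> S"

definition prob_Yd :: "nat \<Rightarrow> nat \<Rightarrow> real \<Rightarrow> (nat set set \<Rightarrow> bool) \<Rightarrow> real" where
  "prob_Yd n d p P =
     (\<Sum>S \<in> {S. S \<subseteq> dsimplices n d \<and> P (Ycomplex n d S)}.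
        p ^ card S * (1 - p) ^ (card (dsimplices n d) - card S))"

definition g_fun :: "nat \<Rightarrow> real \<Rightarrow> real" where
  "g_fun d x = real (d + 1) * (x + 1) * exp (- x) + x * (1 - exp (- x)) ^ (d + 1)"

definition c_thr :: "nat \<Rightarrow> real" where
  "c_thr d = (THE x. x > 0 \<and> g_fun d x = real (d + 1))"

end

theory Submission
  imports Defs "HOL-Library.Disjoint_Sets"
begin

text \<open>A \<open>d\<close>-chain supported on the \<open>d\<close>-simplices all of whose facets lie in at least two simplices has
  its boundary supported on the \<open>(d - 1)\<close>-faces of degree at least two. So as soon as there are more
  such simplices than such faces, linear algebra yields a nonzero cycle, and there are no nonzero
  boundaries. The mean of the difference of the two counts is asymptotically
  \<open>n ^ d * (g_fun d c - (d + 1)) / fact (d + 1)\<close>, which is positive for \<open>c > c_thr d\<close>. Adding one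
  simplex changes the difference by at most \<open>d + 2\<close>, so by Efron-Stein its variance is only of order
  \<open>n ^ d\<close>, and Chebyshev's inequality concludes.\<close>

section \<open>Random subsets\<close>

text \<open>The expectation is a weighted finite sum, in the same shape as \<open>prob_Yd\<close>.
  Identities about it are polynomial in \<open>p\<close>; signs of the weights matter only for
  inequalities.\<close>

definition bernoulli_mean :: "real \<Rightarrow> 'b set \<Rightarrow> ('b set \<Rightarrow> real) \<Rightarrow> real" where
  "bernoulli_mean p A f = (\<Sum>S\<in>Pow A. p ^ card S * (1 - p) ^ (card A - card S) * f S)"

lemma bernoulli_mean_empty [simp]: "bernoulli_mean p {} f = f {}"
  by (simp add: bernoulli_mean_def)

text \<open>Conditioning on whether \<open>a\<close> is drawn. This recursion drives the inductions
  on the ground set below.\<close>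

lemma bernoulli_mean_insert:
  assumes "finite A" "a \<notin> A"
  shows "bernoulli_mean p (insert a A) f =
    p * bernoulli_mean p A (\<lambda>S. f (insert a S)) + (1 - p) * bernoulli_mean p A f"
proof -
  have inj: "inj_on (insert a) (Pow A)"
    using assms by (auto simp: inj_on_def)
  have disj: "Pow A \<inter> insert a ` Pow A = {}"
    using assms by auto
  have "bernoulli_mean p (insert a A) f =
     (\<Sum>S\<in>Pow A. p ^ card S * (1 - p) ^ (Suc (card A) - card S) * f S) +
     (\<Sum>S\<in>insert a ` Pow A. p ^ card S * (1 - p) ^ (Suc (card A) - card S) * f S)"
    using assms disj by (simp add: bernoulli_mean_def Pow_insert sum.union_disjoint)
  also have "(\<Sum>S\<in>insert a ` Pow A. p ^ card S * (1 - p) ^ (Suc (card A) - card S) * f S) =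
     (\<Sum>S\<in>Pow A. p * (p ^ card S * (1 - p) ^ (card A - card S) * f (insert a S)))"
    unfolding sum.reindex[OF inj]
  proof (rule sum.cong)
    fix S assume "S \<in> Pow A"
    then have "card (insert a S) = Suc (card S)"
      using assms finite_subset by (subst card_insert_disjoint) auto
    then show "((\<lambda>S. p ^ card S * (1 - p) ^ (Suc (card A) - card S) * f S) \<circ> insert a) S =
       p * (p ^ card S * (1 - p) ^ (card A - card S) * f (insert a S))"
      by simp
  qed simp
  also have "(\<Sum>S\<in>Pow A. p ^ card S * (1 - p) ^ (Suc (card A) - card S) * f S) =
     (\<Sum>S\<in>Pow A. (1 - p) * (p ^ card S * (1 - p) ^ (card A - card S) * f S))"
  proof (rule sum.cong)
    fix S assume "S \<in> Pow A"
    \<comment> \<open>This rules out truncation in the exponent, so the larger ground set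
      contributes exactly one more factor \<open>1 - p\<close>.\<close>
    then have "card S \<le> card A"
      using assms by (simp add: card_mono)
    then show "p ^ card S * (1 - p) ^ (Suc (card A) - card S) * f S =
       (1 - p) * (p ^ card S * (1 - p) ^ (card A - card S) * f S)"
      by (simp add: Suc_diff_le)
  qed simp
  finally show ?thesis
    by (simp add: bernoulli_mean_def sum_distrib_left)
qed

lemma bernoulli_mean_cong:
  assumes "\<And>S. S \<subseteq> A \<Longrightarrow> f S = g S"
  shows "bernoulli_mean p A f = bernoulli_mean p A g"
  using assms by (auto simp: bernoulli_mean_def intro!: sum.cong)

lemma bernoulli_mean_diff:
  "bernoulli_mean p A (\<lambda>S. f S - g S) = bernoulli_mean p A f - bernoulli_mean p A g"
  by (simp add: bernoulli_mean_def right_diff_distrib sum_subtractf)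

lemma bernoulli_mean_cmult:
  "bernoulli_mean p A (\<lambda>S. r * f S) = r * bernoulli_mean p A f"
  by (simp add: bernoulli_mean_def sum_distrib_left mult.left_commute)

lemma bernoulli_mean_sum:
  "bernoulli_mean p A (\<lambda>S. \<Sum>i\<in>I. f i S) = (\<Sum>i\<in>I. bernoulli_mean p A (f i))"
  unfolding bernoulli_mean_def sum_distrib_left by (rule sum.swap)

lemma bernoulli_mean_const:
  "finite A \<Longrightarrow> bernoulli_mean p A (\<lambda>_. r) = r"
  by (induction rule: finite_induct) (simp_all add: bernoulli_mean_insert algebra_simps)

lemma bernoulli_mean_mono:
  assumes "0 \<le> p" "p \<le> 1" "\<And>S. S \<subseteq> A \<Longrightarrow> f S \<le> g S"
  shows "bernoulli_mean p A f \<le> bernoulli_mean p A g"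
  unfolding bernoulli_mean_def using assms by (intro sum_mono mult_left_mono) auto

text \<open>The element \<open>a\<close> lies in at most one of \<open>C\<close> and
  \<open>D\<close>, so drawing it alters at most one factor. Generalizing over \<open>f\<close> and
  \<open>g\<close> lets the induction hypothesis apply to the altered factor as well.\<close>

lemma bernoulli_mean_indep:
  assumes "finite A" "C \<inter> D = {}"
  shows "bernoulli_mean p A (\<lambda>S. f (S \<inter> C) * g (S \<inter> D)) =
    bernoulli_mean p A (\<lambda>S. f (S \<inter> C)) * bernoulli_mean p A (\<lambda>S. g (S \<inter> D))"
  using assms(1)
proof (induction arbitrary: f g rule: finite_induct)
  case (insert a A)
  consider "a \<in> C" "a \<notin> D" | "a \<notin> C" "a \<in> D" | "a \<notin> C" "a \<notin> D"
    using assms(2) by blast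
  then show ?case
  proof cases
    case 1
    with insert.IH[of "\<lambda>S. f (insert a S)" g] insert.IH[of f g] insert.hyps show ?thesis
      by (simp add: bernoulli_mean_insert algebra_simps)
  next
    case 2
    with insert.IH[of f "\<lambda>S. g (insert a S)"] insert.IH[of f g] insert.hyps show ?thesis
      by (simp add: bernoulli_mean_insert algebra_simps)
  next
    case 3
    with insert.IH[of f g] insert.hyps show ?thesis
      by (simp add: bernoulli_mean_insert algebra_simps)
  qed
qed simp

text \<open>If \<open>a\<close> lies in \<open>B\<close>, the branch that draws \<open>a\<close>
  contributes nothing and the other one leaves \<open>B - {a}\<close> to be avoided; otherwise both
  branches coincide.\<close>

lemma bernoulli_mean_avoid:
  assumes "finite A" "B \<subseteq> A"
  shows "bernoulli_mean p A (\<lambda>S. of_bool (S \<inter> B = {})) = (1 - p) ^ card B"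
  using assms
proof (induction arbitrary: B rule: finite_induct)
  case (insert a A)
  show ?case
  proof (cases "a \<in> B")
    case True
    have "finite B"
      using insert.prems insert.hyps finite_subset by blast
    have "bernoulli_mean p A (\<lambda>S. of_bool (S \<inter> B = {})) =
        bernoulli_mean p A (\<lambda>S. of_bool (S \<inter> (B - {a}) = {}))"
      using insert.hyps by (intro bernoulli_mean_cong arg_cong[where f = of_bool]) blast
    also have "\<dots> = (1 - p) ^ card (B - {a})"
      using insert.prems by (intro insert.IH) auto
    finally have "(1 - p) * bernoulli_mean p A (\<lambda>S. of_bool (S \<inter> B = {})) = (1 - p) ^ card B"
      by (simp add: card.remove[OF \<open>finite B\<close> True])
    moreover have "bernoulli_mean p A (\<lambda>S. of_bool (insert a S \<inter> B = {})) =
        bernoulli_mean p A (\<lambda>S. 0)"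
      using True by (intro bernoulli_mean_cong) auto
    ultimately show ?thesis
      by (simp only: bernoulli_mean_insert[OF insert.hyps] bernoulli_mean_const[OF insert.hyps(1)])
  next
    case False
    then have "bernoulli_mean p A (\<lambda>S. of_bool (insert a S \<inter> B = {})) =
        bernoulli_mean p A (\<lambda>S. of_bool (S \<inter> B = {}))"
      by (intro bernoulli_mean_cong) auto
    moreover have "bernoulli_mean p A (\<lambda>S. of_bool (S \<inter> B = {})) = (1 - p) ^ card B"
      using False insert.prems by (intro insert.IH) auto
    ultimately show ?thesis
      by (simp only: bernoulli_mean_insert[OF insert.hyps]) (simp add: algebra_simps)
  qed
qed simp

lemma bernoulli_mean_member:
  assumes "finite A" "a \<in> A"
  shows "bernoulli_mean p A (\<lambda>S. of_bool (a \<in> S)) = p"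
proof -
  have "bernoulli_mean p A (\<lambda>S. of_bool (a \<in> S)) =
      bernoulli_mean p A (\<lambda>S. 1 - of_bool (S \<inter> {a} = {}))"
    by (rule bernoulli_mean_cong) auto
  then show ?thesis
    using assms bernoulli_mean_avoid[of A "{a}" p]
    by (simp add: bernoulli_mean_diff bernoulli_mean_const)
qed

text \<open>Hitting pairwise disjoint blocks gives independent events; the blocks are split off one
  at a time.\<close>

lemma bernoulli_mean_hit_all:
  assumes "finite A" "finite I" "\<And>i. i \<in> I \<Longrightarrow> B i \<subseteq> A" "disjoint_family_on B I"
  shows "bernoulli_mean p A (\<lambda>S. of_bool (\<forall>i\<in>I. S \<inter> B i \<noteq> {})) =
    (\<Prod>i\<in>I. 1 - (1 - p) ^ card (B i))"
  using assms(2-)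
proof (induction I rule: finite_induct)
  case empty
  then show ?case
    using assms(1) by (simp add: bernoulli_mean_const)
next
  case (insert i I)
  let ?D = "\<Union>j\<in>I. B j"
  have disj: "B i \<inter> ?D = {}"
    using insert.hyps insert.prems by (auto simp: disjoint_family_on_def)
  \<comment> \<open>Intersecting with \<open>?D\<close> is harmless here and brings the second
    factor into the form \<open>g (S \<inter> D)\<close> that \<open>bernoulli_mean_indep\<close>
    expects.\<close>
  have *: "S \<inter> ?D \<inter> B j = S \<inter> B j" if "j \<in> I" for S j
    using that by auto
  have "bernoulli_mean p A (\<lambda>S. of_bool (\<forall>j\<in>insert i I. S \<inter> B j \<noteq> {})) =
      bernoulli_mean p A (\<lambda>S. of_bool (S \<inter> B i \<noteq> {}) *
        of_bool (\<forall>j\<in>I. S \<inter> ?D \<inter> B j \<noteq> {}))"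
    using * by (intro bernoulli_mean_cong) auto
  also have "\<dots> = bernoulli_mean p A (\<lambda>S. of_bool (S \<inter> B i \<noteq> {})) *
      bernoulli_mean p A (\<lambda>S. of_bool (\<forall>j\<in>I. S \<inter> ?D \<inter> B j \<noteq> {}))"
    using bernoulli_mean_indep[OF assms(1) disj, of p "\<lambda>X. of_bool (X \<noteq> {})"
        "\<lambda>X. of_bool (\<forall>j\<in>I. X \<inter> B j \<noteq> {})"] by simp
  also have "bernoulli_mean p A (\<lambda>S. of_bool (\<forall>j\<in>I. S \<inter> ?D \<inter> B j \<noteq> {})) =
      bernoulli_mean p A (\<lambda>S. of_bool (\<forall>j\<in>I. S \<inter> B j \<noteq> {}))"
    using * by (intro bernoulli_mean_cong) auto
  also have "\<dots> = (\<Prod>j\<in>I. 1 - (1 - p) ^ card (B j))"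
    using insert.prems by (intro insert.IH) (auto simp: disjoint_family_on_def)
  also have "bernoulli_mean p A (\<lambda>S. of_bool (S \<inter> B i \<noteq> {})) = 1 - (1 - p) ^ card (B i)"
    using assms(1) insert.prems(1)[of i]
    by (simp add: of_bool_not_iff bernoulli_mean_diff bernoulli_mean_const bernoulli_mean_avoid)
  finally show ?case
    using insert.hyps by simp
qed

section \<open>Variance and concentration\<close>

text \<open>Efron-Stein for bounded differences. By the law of total variance each new element adds
  the variance \<open>p * (1 - p)\<close> of its coin times the squared gap of the two conditional
  means, and that gap is at most \<open>K\<close>.\<close>

lemma bernoulli_variance_le:
  fixes p K :: real
  assumes "finite A" "0 \<le> p" "p \<le> 1" "0 \<le> K"
    and "\<And>a S. a \<in> A \<Longrightarrow> S \<subseteq> A \<Longrightarrow> a \<notin> S \<Longrightarrow> \<bar>f (insert a S) - f S\<bar> \<le> K"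
  shows "bernoulli_mean p A (\<lambda>S. (f S)\<^sup>2) - (bernoulli_mean p A f)\<^sup>2 \<le> card A * (p * (1 - p) * K\<^sup>2)"
  using assms(1,5)
proof (induction arbitrary: f rule: finite_induct)
  case (insert a A)
  let ?E = "bernoulli_mean p A"
  let ?f1 = "\<lambda>S. f (insert a S)"
  have v0: "?E (\<lambda>S. (f S)\<^sup>2) - (?E f)\<^sup>2 \<le> card A * (p * (1 - p) * K\<^sup>2)"
    using insert.prems by (intro insert.IH) auto
  have v1: "?E (\<lambda>S. (?f1 S)\<^sup>2) - (?E ?f1)\<^sup>2 \<le> card A * (p * (1 - p) * K\<^sup>2)"
  proof (rule insert.IH)
    fix b S assume b: "b \<in> A" "S \<subseteq> A" "b \<notin> S"
    \<comment> \<open>Swapping the insertions turns the increment of \<open>?f1\<close> at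
      \<open>S\<close> into the increment of \<open>f\<close> at \<open>insert a S\<close>.\<close>
    have "insert a (insert b S) = insert b (insert a S)" by auto
    then show "\<bar>f (insert a (insert b S)) - f (insert a S)\<bar> \<le> K"
      using insert.prems[of b "insert a S"] b insert.hyps by auto
  qed
  have d: "\<bar>f (insert a S) - f S\<bar> \<le> K" if "S \<subseteq> A" for S
    using insert.prems[of a S] that insert.hyps by auto
  have "?E (\<lambda>S. ?f1 S - f S) \<le> ?E (\<lambda>_. K)" "?E (\<lambda>_. - K) \<le> ?E (\<lambda>S. ?f1 S - f S)"
    using assms(2,3) d by (auto intro!: bernoulli_mean_mono simp: abs_le_iff) (smt (verit))
  then have "\<bar>?E ?f1 - ?E f\<bar> \<le> K"
    using insert.hyps by (simp add: bernoulli_mean_diff bernoulli_mean_const)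
  then have k: "(?E ?f1 - ?E f)\<^sup>2 \<le> K\<^sup>2"
    using assms(4) by (simp add: abs_le_square_iff[symmetric])
  \<comment> \<open>Law of total variance for the coin of \<open>a\<close>: the averaged conditional
    variances plus the variance of the conditional mean.\<close>
  have "bernoulli_mean p (insert a A) (\<lambda>S. (f S)\<^sup>2) - (bernoulli_mean p (insert a A) f)\<^sup>2 =
     p * (?E (\<lambda>S. (?f1 S)\<^sup>2) - (?E ?f1)\<^sup>2) + (1 - p) * (?E (\<lambda>S. (f S)\<^sup>2) - (?E f)\<^sup>2)
     + p * (1 - p) * (?E ?f1 - ?E f)\<^sup>2"
    using insert.hyps by (simp add: bernoulli_mean_insert power2_eq_square algebra_simps)
  also have "\<dots> \<le> p * (card A * (p * (1 - p) * K\<^sup>2)) + (1 - p) * (card A * (p * (1 - p) * K\<^sup>2))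
      + p * (1 - p) * K\<^sup>2"
    using assms(2,3) v0 v1 k by (intro add_mono mult_left_mono) auto
  finally show ?case
    using insert.hyps by (simp add: algebra_simps)
qed simp

text \<open>With \<open>m\<close> the mean, the indicator of \<open>f S > 0\<close> dominates
  \<open>1 - (f S / m - 1)^2\<close> pointwise: this is at most 1 always, and at most 0 once
  \<open>f S \<le> 0\<close>. Taking means of both sides gives the bound.\<close>

lemma bernoulli_chebyshev:
  assumes "finite A" "0 \<le> p" "p \<le> 1" "bernoulli_mean p A f > 0"
  shows "1 - (bernoulli_mean p A (\<lambda>S. (f S)\<^sup>2) - (bernoulli_mean p A f)\<^sup>2) / (bernoulli_mean p A f)\<^sup>2
    \<le> bernoulli_mean p A (\<lambda>S. of_bool (f S > 0))"
proof -
  define m where "m = bernoulli_mean p A f"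
  have m: "m > 0" using assms(4) by (simp add: m_def)
  have "bernoulli_mean p A (\<lambda>S. 2 / m * f S - 1 / m\<^sup>2 * (f S)\<^sup>2)
      \<le> bernoulli_mean p A (\<lambda>S. of_bool (f S > 0))"
  proof (rule bernoulli_mean_mono[OF assms(2,3)])
    fix S assume "S \<subseteq> A"
    have "2 / m * f S - 1 / m\<^sup>2 * (f S)\<^sup>2 = 1 - (f S / m - 1)\<^sup>2"
      using m by (simp add: power2_eq_square field_simps)
    moreover have "f S / m - 1 \<le> -1" if "f S \<le> 0"
      using m that by (simp add: divide_nonpos_pos)
    then have "1 \<le> (f S / m - 1)\<^sup>2" if "f S \<le> 0"
      using that by (smt (verit) power2_minus one_le_power)
    ultimately show "2 / m * f S - 1 / m\<^sup>2 * (f S)\<^sup>2 \<le> of_bool (f S > 0)"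
      by (auto simp: of_bool_def not_less)
  qed
  also have "bernoulli_mean p A (\<lambda>S. 2 / m * f S - 1 / m\<^sup>2 * (f S)\<^sup>2) =
     2 / m * m - 1 / m\<^sup>2 * bernoulli_mean p A (\<lambda>S. (f S)\<^sup>2)"
    by (simp add: bernoulli_mean_diff bernoulli_mean_cmult m_def del: times_divide_eq_left)
  also have "\<dots> = 1 - (bernoulli_mean p A (\<lambda>S. (f S)\<^sup>2) - m\<^sup>2) / m\<^sup>2"
    using m by (simp add: field_simps)
  finally show ?thesis
    by (simp add: m_def)
qed

section \<open>The threshold\<close>

text \<open>The numerator of the derivative is \<open>1 - (1 - t) * exp t\<close>, which is
  nonnegative because \<open>1 - t \<le> exp (- t)\<close>.\<close>

lemma exp_minus_one_quotient_mono:
  assumes "0 < x" "x \<le> (y::real)"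
  shows "(exp x - 1) / x \<le> (exp y - 1) / y"
proof (rule DERIV_nonneg_imp_nondecreasing[OF assms(2)])
  fix t :: real assume t: "x \<le> t" "t \<le> y"
  then have "t > 0" using assms by simp
  have "(1 - t) * exp t \<le> exp (- t) * exp t"
    using exp_ge_add_one_self[of "- t"] by (intro mult_right_mono) auto
  then have "(1 - t) * exp t \<le> 1"
    by (simp add: exp_minus)
  then have "0 \<le> (exp t * t - (exp t - 1)) / (t * t)"
    using \<open>t > 0\<close> by (simp add: algebra_simps)
  moreover have "((\<lambda>t. (exp t - 1) / t) has_real_derivative (exp t * t - (exp t - 1)) / (t * t)) (at t)"
    using \<open>t > 0\<close> by (auto intro!: derivative_eq_intros)
  ultimately show "\<exists>D. ((\<lambda>t. (exp t - 1) / t) has_real_derivative D) (at t) \<and> 0 \<le> D"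
    by blast
qed

definition g_deriv :: "nat \<Rightarrow> real \<Rightarrow> real" where
  "g_deriv d x = (1 - exp (- x)) ^ (d + 1) - (d + 1) * x * exp (- x) * (1 - (1 - exp (- x)) ^ d)"

lemma g_fun_has_derivative:
  "(g_fun d has_real_derivative g_deriv d x) (at x)"
proof -
  have "((\<lambda>x. real (d + 1) * (x + 1) * exp (- x) + x * (1 - exp (- x)) ^ (d + 1))
     has_real_derivative g_deriv d x) (at x)"
    unfolding g_deriv_def
    by (rule derivative_eq_intros refl | simp)+ (simp add: algebra_simps)
  then show ?thesis
    by (simp add: g_fun_def[abs_def])
qed

text \<open>Dividing the equation \<open>g_deriv d x = 0\<close> by \<open>(1 - exp (- x)) ^ (d + 1)\<close> turns it into
  \<open>\<psi> x = 1\<close> for a strictly decreasing function \<open>\<psi>\<close>.\<close>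

lemma g_deriv_zero_unique:
  assumes "0 < x" "x < y" "d \<ge> 1" "g_deriv d x = 0"
  shows "g_deriv d y \<noteq> 0"
proof
  assume "g_deriv d y = 0"
  define \<psi> where "\<psi> t = real (d + 1) * (t / (exp t - 1)) * (1 / (1 - exp (- t)) ^ d - 1)" for t
  have one: "\<psi> t = 1" if "t > 0" "g_deriv d t = 0" for t
  proof -
    \<comment> \<open>In terms of \<open>u\<close>, \<open>t / (exp t - 1)\<close> is
      \<open>t * (1 - u) / u\<close>, and \<open>g_deriv d t = 0\<close> says that the numerator of
      \<open>\<psi> t\<close> over \<open>u ^ (d + 1)\<close> equals that denominator.\<close>
    define u where "u = 1 - exp (- t)"
    have u: "0 < u" "u < 1" and e: "exp (- t) = 1 - u"
      using that by (auto simp: u_def)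
    have "exp t = 1 / (1 - u)"
      by (metis e exp_minus inverse_eq_divide inverse_inverse_eq)
    then have et: "exp t - 1 = u / (1 - u)"
      using u by (simp add: divide_simps) (simp add: algebra_simps)
    have pow: "u ^ (d + 1) = (d + 1) * t * (1 - u) * (1 - u ^ d)"
      using that(2) by (simp add: g_deriv_def e)
    have "\<psi> t = (d + 1) * t * (1 - u) * (1 - u ^ d) / u ^ (d + 1)"
      using u unfolding \<psi>_def et u_def[symmetric] by (simp add: divide_simps)
    also have "\<dots> = 1"
      unfolding pow[symmetric] using u by simp
    finally show ?thesis .
  qed
  have y: "0 < y" using assms by simp
  \<comment> \<open>The first factor of \<open>\<psi>\<close> is positive and does not increase; the
    second is nonnegative and strictly decreases. So the product strictly decreases.\<close>
  have "y / (exp y - 1) \<le> x / (exp x - 1)"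
    using exp_minus_one_quotient_mono[of x y] assms y by (simp add: field_simps)
  moreover have "1 / (1 - exp (- y)) ^ d < 1 / (1 - exp (- x)) ^ d"
    using assms y by (intro divide_strict_left_mono power_strict_mono mult_pos_pos) auto
  moreover have "1 \<le> 1 / (1 - exp (- y)) ^ d"
    using y by (simp add: power_le_one)
  moreover have "y / (exp y - 1) > 0"
    using y by simp
  ultimately have "(y / (exp y - 1)) * (1 / (1 - exp (- y)) ^ d - 1)
      < (x / (exp x - 1)) * (1 / (1 - exp (- x)) ^ d - 1)"
    by (intro mult_le_less_imp_less) auto
  then have "real (d + 1) * ((y / (exp y - 1)) * (1 / (1 - exp (- y)) ^ d - 1))
      < real (d + 1) * ((x / (exp x - 1)) * (1 / (1 - exp (- x)) ^ d - 1))"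
    by (intro mult_strict_left_mono) auto
  then have "\<psi> y < \<psi> x"
    by (simp only: \<psi>_def mult.assoc)
  then show False
    using one[of x] one[of y] assms y \<open>g_deriv d y = 0\<close> by simp
qed

lemma g_fun_continuous_on: "continuous_on A (g_fun d)"
  by (intro continuous_at_imp_continuous_on ballI DERIV_isCont[OF g_fun_has_derivative])

text \<open>The value \<open>d + 1\<close> is also attained at 0. Two distinct positive solutions
  would thus give, by Rolle, two positive critical points, against
  \<open>g_deriv_zero_unique\<close>.\<close>

lemma g_fun_root_unique:
  assumes "d \<ge> 1" "0 < x" "0 < y" "g_fun d x = d + 1" "g_fun d y = d + 1"
  shows "x = y"
proof -
  have no: False if ab: "0 < a" "a < b" "g_fun d a = d + 1" "g_fun d b = d + 1" for a b
  proof -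
    have crit: "\<exists>s>r. s < t \<and> g_deriv d s = 0" if "r < t" "g_fun d r = g_fun d t" for r t
    proof -
      have "\<exists>s>r. s < t \<and> (g_fun d has_real_derivative 0) (at s)"
        using that g_fun_continuous_on g_fun_has_derivative real_differentiable_def
        by (intro Rolle) blast+
      then show ?thesis
        using DERIV_unique[OF g_fun_has_derivative] by blast
    qed
    have "g_fun d 0 = g_fun d a" "g_fun d a = g_fun d b"
      using ab by (auto simp: g_fun_def)
    then obtain s t where "0 < s" "s < a" "g_deriv d s = 0" "a < t" "t < b" "g_deriv d t = 0"
      using crit[of 0 a] crit[of a b] ab by blast
    then show False
      using g_deriv_zero_unique[of s t d] assms(1) by simp
  qed
  show ?thesis
    using no[of x y] no[of y x] assms by (cases x y rule: linorder_cases) auto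
qed

text \<open>With \<open>q = exp (- 1)\<close> the value is
  \<open>2 * (d + 1) * q + (1 - q) ^ (d + 1)\<close>, so it suffices that
  \<open>(d + 1) * (1 - 2 * q)\<close> is at least \<open>1 - q\<close>. For
  \<open>d + 1 \<ge> 3\<close> this follows from \<open>q \<le> 2 / 5\<close>.\<close>

lemma g_fun_one_less:
  assumes "d \<ge> 2"
  shows "g_fun d 1 < d + 1"
proof -
  define q where "q = exp (- 1 :: real)"
  have "exp 1 * q = 1" "q > 0"
    by (auto simp: q_def exp_minus)
  moreover have "5 / 2 \<le> exp (1::real)"
    using exp_lower_Taylor_quadratic[of 1] by simp
  then have "5 / 2 * q \<le> exp 1 * q"
    using \<open>q > 0\<close> by (intro mult_right_mono) auto
  ultimately have q: "0 < q" "q \<le> 2 / 5" by auto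
  have "(1 - q) ^ (d + 1) < (1 - q) ^ 1"
    using q assms by (intro power_strict_decreasing) auto
  moreover have "(d + 1) * (1 - 2 * q) \<ge> 3 * (1 - 2 * q)"
    using q assms by (intro mult_right_mono) auto
  ultimately show ?thesis
    using q unfolding g_fun_def q_def[symmetric] by (simp add: algebra_simps)
qed

text \<open>The first summand is positive. By Bernoulli's inequality and
  \<open>x * exp (- x) \<le> 1\<close> the second is at least \<open>x - (d + 1)\<close>, hence at
  least \<open>d + 2\<close>.\<close>

lemma g_fun_large:
  fixes x :: real
  assumes "x \<ge> 2 * d + 3"
  shows "g_fun d x > d + 1"
proof -
  define q where "q = exp (- x)"
  have x: "x > 0" using assms by linarith
  have q: "0 < q" "q < 1" using x by (auto simp: q_def)
  have "x * q \<le> exp x * q"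
    using exp_ge_add_one_self[of x] q by (intro mult_right_mono) (linarith | simp)+
  then have xq: "x * q \<le> 1" by (simp add: q_def exp_minus)
  have "1 + real (d + 1) * (- q) \<le> (1 + (- q)) ^ (d + 1)"
    using q by (intro Bernoulli_inequality) auto
  then have "x * (1 - real (d + 1) * q) \<le> x * (1 - q) ^ (d + 1)"
    using x by (intro mult_left_mono) auto
  moreover have "real (d + 1) * (x * q) \<le> real (d + 1) * 1"
    using xq by (intro mult_left_mono) auto
  moreover have "real (d + 1) * (x + 1) * q > 0"
    using x q by simp
  ultimately show ?thesis
    using assms unfolding g_fun_def q_def[symmetric] by (simp add: algebra_simps)
qed

text \<open>The values at 1 and at \<open>2 * d + 3\<close> enclose \<open>d + 1\<close>, so a
  solution exists; being unique, it is the one that the description operator in \<open>c_thr\<close>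
  denotes.\<close>

lemma above_c_thr:
  assumes "d \<ge> 2" "c > c_thr d"
  shows "c > 0" "g_fun d c > d + 1"
proof -
  have "\<exists>x\<ge>1. x \<le> real (2 * d + 3) \<and> g_fun d x = d + 1"
    using g_fun_one_less[OF assms(1)] g_fun_large[of d "2 * d + 3"]
    by (intro IVT' g_fun_continuous_on) auto
  then obtain r where r: "r \<ge> 1" "g_fun d r = d + 1" by blast
  have uniq: "y = r" if "y > 0" "g_fun d y = d + 1" for y
    using g_fun_root_unique[of d y r] that r assms(1) by simp
  have "c_thr d = r"
    unfolding c_thr_def using r uniq by (intro the_equality) auto
  then have c: "c > r" using assms by simp
  then show "c > 0" using r by simp
  show "g_fun d c > d + 1"
  proof (rule ccontr)
    assume *: "\<not> ?thesis"
    \<comment> \<open>If the value at \<open>c\<close> were at most \<open>d + 1\<close>, the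
      intermediate value theorem would produce a second solution to the right of \<open>c\<close>,
      beyond \<open>r\<close>.\<close>
    have "\<exists>y\<ge>c. y \<le> max c (2 * d + 3) \<and> g_fun d y = d + 1"
      using * g_fun_large[of d "max c (2 * d + 3)"] by (intro IVT' g_fun_continuous_on) auto
    then show False
      using uniq c r by force
  qed
qed

section \<open>Simplices without free facets\<close>

text \<open>Gaussian elimination by induction on the equations \<open>B\<close>: an equation that is
  trivial on \<open>A\<close> is dropped, any other one is used to eliminate one unknown. Both cases
  keep fewer equations than unknowns.\<close>

lemma underdetermined_system:
  fixes M :: "'b \<Rightarrow> 'a \<Rightarrow> 'f::field"
  assumes "finite B" "finite A" "card B < card A"
  shows "\<exists>z. z \<noteq> (\<lambda>_. 0) \<and> (\<forall>a. a \<notin> A \<longrightarrow> z a = 0) \<and> (\<forall>b\<in>B. (\<Sum>a\<in>A. z a * M b a) = 0)"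
  using assms
proof (induction arbitrary: A M rule: finite_induct)
  case empty
  then obtain a where "a \<in> A" by fastforce
  then show ?case
    by (intro exI[of _ "\<lambda>x. of_bool (x = a)"]) (auto simp: fun_eq_iff)
next
  case (insert b B)
  show ?case
  proof (cases "\<forall>a\<in>A. M b a = 0")
    case True
    have "card B < card A" using insert.prems insert.hyps by simp
    from insert.IH[OF insert.prems(1) this, of M] obtain z where
      z: "z \<noteq> (\<lambda>_. 0)" "\<forall>a. a \<notin> A \<longrightarrow> z a = 0" "\<forall>b\<in>B. (\<Sum>a\<in>A. z a * M b a) = 0"
      by blast
    then show ?thesis
      using True by (intro exI[of _ z]) (auto intro!: sum.neutral)
  next
    case False
    then obtain a where a: "a \<in> A" "M b a \<noteq> 0" by blast
    \<comment> \<open>The matrix after clearing column \<open>a\<close> with the pivot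
      \<open>M b a\<close>.\<close>
    define N where "N b' x = M b' x - M b' a * M b x / M b a" for b' x
    have "card B < card (A - {a})"
      using insert.prems insert.hyps a(1) by simp
    from insert.IH[OF _ this, of N] insert.prems(1) obtain z where
      z: "z \<noteq> (\<lambda>_. 0)" "\<forall>x. x \<notin> A - {a} \<longrightarrow> z x = 0"
        "\<forall>b'\<in>B. (\<Sum>x\<in>A - {a}. z x * N b' x) = 0"
      by auto
    define s where "s = (\<Sum>x\<in>A - {a}. z x * M b x)"
    \<comment> \<open>Back substitution: the value at \<open>a\<close> is the one forced by equation
      \<open>b\<close>.\<close>
    define w where "w = z(a := - s / M b a)"
    have w: "(\<Sum>x\<in>A. w x * M b' x) = - s / M b a * M b' a + (\<Sum>x\<in>A - {a}. z x * M b' x)" for b'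
      using insert.prems(1) a(1) by (simp add: w_def sum.remove)
    have "(\<Sum>x\<in>A. w x * M b x) = 0"
      using a by (simp add: w s_def)
    moreover have "(\<Sum>x\<in>A. w x * M b' x) = 0" if "b' \<in> B" for b'
    proof -
      have "0 = (\<Sum>x\<in>A - {a}. z x * N b' x)"
        using z that by simp
      also have "\<dots> = (\<Sum>x\<in>A - {a}. z x * M b' x - M b' a / M b a * (z x * M b x))"
        by (intro sum.cong) (auto simp: N_def algebra_simps)
      also have "\<dots> = (\<Sum>x\<in>A - {a}. z x * M b' x) - M b' a / M b a * s"
        by (simp add: sum_subtractf s_def sum_distrib_left)
      finally show ?thesis
        by (simp add: w algebra_simps)
    qed
    moreover have "w \<noteq> (\<lambda>_. 0)"
    proof -
      obtain x where "z x \<noteq> 0" using z(1) by auto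
      then have "x \<noteq> a" using z(2) by auto
      then have "w x \<noteq> 0" using \<open>z x \<noteq> 0\<close> by (simp add: w_def)
      then show ?thesis by auto
    qed
    moreover have "w x = 0" if "x \<notin> A" for x
      using that z(2) a(1) by (auto simp: w_def)
    ultimately show ?thesis
      by (intro exI[of _ w]) auto
  qed
qed

section \<open>From a surplus of shared simplices to a nonzero cycle\<close>

definition shared_simplices :: "'a set set \<Rightarrow> 'a set set" where
  "shared_simplices S = {\<sigma> \<in> S. \<forall>v\<in>\<sigma>. \<exists>\<rho>\<in>S. \<rho> \<noteq> \<sigma> \<and> \<sigma> - {v} \<subseteq> \<rho>}"

definition shared_ridges :: "nat \<Rightarrow> nat \<Rightarrow> nat set set \<Rightarrow> nat set set" where
  "shared_ridges n d S =
    {\<tau>. \<tau> \<subseteq> {..<n} \<and> card \<tau> = d \<and> (\<exists>\<sigma>\<in>S. \<exists>\<rho>\<in>S. \<rho> \<noteq> \<sigma> \<and> \<tau> \<subseteq> \<sigma> \<and> \<tau> \<subseteq> \<rho>)}"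

lemma finite_dsimplices [simp]: "finite (dsimplices n d)"
  by (rule finite_subset[of _ "Pow {..<n}"]) (auto simp: dsimplices_def)

lemma card_dsimplices: "card (dsimplices n d) = n choose Suc d"
  unfolding dsimplices_def using n_subsets[of "{..<n}" "Suc d"] by simp

lemma finite_shared_ridges [simp]: "finite (shared_ridges n d S)"
  by (rule finite_subset[of _ "Pow {..<n}"]) (auto simp: shared_ridges_def)

lemma finite_shared_simplices: "finite S \<Longrightarrow> finite (shared_simplices S)"
  by (simp add: shared_simplices_def)

lemma dsimplicesD:
  assumes "\<sigma> \<in> dsimplices n d"
  shows "\<sigma> \<subseteq> {..<n}" "card \<sigma> = Suc d" "finite \<sigma>"
  using assms finite_subset[of \<sigma> "{..<n}"] by (auto simp: dsimplices_def)

text \<open>Expanding \<open>z\<close> in indicator chains exhibits the boundary as a matrix acting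
  on the coefficients, the form that \<open>underdetermined_system\<close> takes.\<close>

lemma bdry_superposition:
  assumes "finite A" "\<forall>\<sigma>. \<sigma> \<notin> A \<longrightarrow> z \<sigma> = 0"
  shows "bdry K k z \<tau> = (\<Sum>\<sigma>\<in>A. z \<sigma> * bdry K k (\<lambda>\<rho>. of_bool (\<rho> = \<sigma>)) \<tau>)"
proof (cases "card \<tau> = k \<and> finite \<tau>")
  case True
  let ?V = "{v. v \<notin> \<tau> \<and> insert v \<tau> \<in> faces K k}"
  have z: "z \<rho> = (\<Sum>\<sigma>\<in>A. z \<sigma> * of_bool (\<rho> = \<sigma>))" for \<rho>
    using assms by (cases "\<rho> \<in> A") (auto simp: of_bool_def if_distrib sum.delta cong: if_cong)
  have "bdry K k z \<tau> = (\<Sum>v\<in>?V. (-1) ^ card {u \<in> \<tau>. u < v} * z (insert v \<tau>))"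
    using True by (simp add: bdry_def)
  also have "\<dots> = (\<Sum>v\<in>?V. \<Sum>\<sigma>\<in>A. z \<sigma> * ((-1) ^ card {u \<in> \<tau>. u < v} * of_bool (insert v \<tau> = \<sigma>)))"
    by (subst z) (simp add: sum_distrib_left mult.left_commute)
  also have "\<dots> = (\<Sum>\<sigma>\<in>A. \<Sum>v\<in>?V. z \<sigma> * ((-1) ^ card {u \<in> \<tau>. u < v} * of_bool (insert v \<tau> = \<sigma>)))"
    by (rule sum.swap)
  also have "\<dots> = (\<Sum>\<sigma>\<in>A. z \<sigma> * bdry K k (\<lambda>\<rho>. of_bool (\<rho> = \<sigma>)) \<tau>)"
    unfolding sum_distrib_left[symmetric] using True by (simp add: bdry_def)
  finally show ?thesis .
next
  case False
  then show ?thesis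
    by (auto simp: bdry_def)
qed

text \<open>The unknowns are coefficients on the shared simplices, the equations say that the
  boundary vanishes at the shared ridges; at every other \<open>\<tau>\<close> it vanishes
  automatically.\<close>

lemma homology_nonzero_if_card_less:
  assumes S: "S \<subseteq> dsimplices n d"
    and less: "card (shared_ridges n d S) < card (shared_simplices S)"
  shows "homology_nonzero TYPE('a::field) (Ycomplex n d S) d"
proof -
  let ?K = "Ycomplex n d S"
  have fd: "faces ?K d = S"
    using S by (auto simp: faces_def Ycomplex_def dsimplices_def)
  \<comment> \<open>Every face has at most \<open>Suc d\<close> vertices, so the only
    \<open>d\<close>-boundary is zero.\<close>
  have "faces ?K (Suc d) = {}"
    using S by (auto simp: faces_def Ycomplex_def dsimplices_def)
  then have bd: "boundaries ?K d \<subseteq> {\<lambda>_. 0 :: 'a}"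
    by (auto simp: boundaries_def chains_def bdry_def fun_eq_iff)
  have "finite S"
    using S by (rule finite_subset) simp
  then have fin: "finite (shared_simplices S)"
    by (rule finite_shared_simplices)
  obtain z :: "nat set \<Rightarrow> 'a" where
    z: "z \<noteq> (\<lambda>_. 0)" "\<forall>\<sigma>. \<sigma> \<notin> shared_simplices S \<longrightarrow> z \<sigma> = 0"
       "\<forall>\<tau>\<in>shared_ridges n d S. (\<Sum>\<sigma>\<in>shared_simplices S.
          z \<sigma> * bdry ?K d (\<lambda>\<rho>. of_bool (\<rho> = \<sigma>)) \<tau>) = 0"
    using underdetermined_system[OF finite_shared_ridges fin less,
        where M = "\<lambda>\<tau> \<sigma>. bdry ?K d (\<lambda>\<rho>. of_bool (\<rho> = \<sigma>)) \<tau>"] by blast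
  have "bdry ?K d z \<tau> = 0" for \<tau>
  proof (cases "\<tau> \<in> shared_ridges n d S")
    case True
    then show ?thesis
      using z(3) by (subst bdry_superposition[OF fin z(2)]) auto
  next
    case False
    \<comment> \<open>If \<open>insert v \<tau>\<close> were shared, its facet \<open>\<tau>\<close>
      would lie in a second simplex of \<open>S\<close> and so be a shared ridge. For
      \<open>card \<tau> \<noteq> d\<close> the value of \<open>bdry\<close> is 0 by
      definition.\<close>
    have "z (insert v \<tau>) = 0" if \<tau>: "card \<tau> = d" "v \<notin> \<tau>" for v
    proof (rule ccontr)
      assume "z (insert v \<tau>) \<noteq> 0"
      then have v: "insert v \<tau> \<in> shared_simplices S"
        using z(2) by blast
      then obtain \<rho> where \<rho>: "\<rho> \<in> S" "\<rho> \<noteq> insert v \<tau>" "insert v \<tau> - {v} \<subseteq> \<rho>"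
        by (auto simp: shared_simplices_def)
      have "insert v \<tau> \<in> S" using v by (simp add: shared_simplices_def)
      moreover have "\<tau> \<subseteq> {..<n}"
        using S \<open>insert v \<tau> \<in> S\<close> by (auto simp: dsimplices_def)
      moreover have "\<tau> \<subseteq> \<rho>" "\<tau> \<subseteq> insert v \<tau>"
        using \<rho>(3) \<tau>(2) by auto
      ultimately have "\<tau> \<in> shared_ridges n d S"
        using \<rho>(1,2) \<tau>(1) unfolding shared_ridges_def mem_Collect_eq
        by (intro conjI bexI[of _ "insert v \<tau>"] bexI[of _ \<rho>])
      then show False using False by blast
    qed
    then show ?thesis
      by (auto simp: bdry_def intro!: sum.neutral)
  qed
  then have "z \<in> cycles ?K d"
    using z(2) by (auto simp: cycles_def chains_def fd shared_simplices_def fun_eq_iff)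
  moreover have "z \<notin> boundaries ?K d"
    using bd z(1) by blast
  ultimately show ?thesis
    by (auto simp: homology_nonzero_def)
qed

section \<open>Effect of a single simplex on the difference of the counts\<close>

definition excess :: "nat \<Rightarrow> nat \<Rightarrow> nat set set \<Rightarrow> real" where
  "excess n d S = real (card (shared_simplices S)) - real (card (shared_ridges n d S))"

text \<open>Inserting \<open>\<sigma>\<close> can create new shared simplices other than \<open>\<sigma>\<close> only by destroying the freeness of
  one of the \<open>d + 1\<close> facets of \<open>\<sigma>\<close>, and a free facet lies in just one simplex of \<open>S\<close>.\<close>

lemma excess_insert_diff_le:
  assumes "S \<subseteq> dsimplices n d" "\<sigma> \<in> dsimplices n d"
  shows "\<bar>excess n d (insert \<sigma> S) - excess n d S\<bar> \<le> d + 2"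
proof -
  let ?F = "{\<tau>. \<tau> \<subseteq> \<sigma> \<and> card \<tau> = d}"
  have F: "finite ?F" "card ?F = d + 1"
    using n_subsets[of \<sigma> d] dsimplicesD[OF assms(2)] by simp_all
  have finS: "finite S"
    using assms(1) by (rule finite_subset) simp
  have r1: "shared_ridges n d S \<subseteq> shared_ridges n d (insert \<sigma> S)"
    unfolding shared_ridges_def by blast
  have r2: "shared_ridges n d (insert \<sigma> S) \<subseteq> shared_ridges n d S \<union> ?F"
    unfolding shared_ridges_def by blast
  have s1: "shared_simplices S \<subseteq> shared_simplices (insert \<sigma> S)"
    by (auto simp: shared_simplices_def)
  \<comment> \<open>\<open>?U \<tau>\<close> holds the simplex of \<open>S\<close> in which
    \<open>\<tau>\<close> is free, and is empty if there is none.\<close>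
  let ?U = "\<lambda>\<tau>. {\<rho> \<in> S. \<tau> \<subseteq> \<rho> \<and> (\<forall>\<rho>'\<in>S. \<tau> \<subseteq> \<rho>' \<longrightarrow> \<rho>' = \<rho>)}"
  have s2: "shared_simplices (insert \<sigma> S) \<subseteq> shared_simplices S \<union> insert \<sigma> (\<Union>\<tau>\<in>?F. ?U \<tau>)"
  proof
    fix \<rho> assume \<rho>: "\<rho> \<in> shared_simplices (insert \<sigma> S)"
    show "\<rho> \<in> shared_simplices S \<union> insert \<sigma> (\<Union>\<tau>\<in>?F. ?U \<tau>)"
    proof (cases "\<rho> = \<sigma> \<or> \<rho> \<in> shared_simplices S")
      case False
      with \<rho> have "\<rho> \<in> S" by (auto simp: shared_simplices_def)
      with False obtain v where v: "v \<in> \<rho>" "\<forall>\<rho>'\<in>S. \<rho> - {v} \<subseteq> \<rho>' \<longrightarrow> \<rho>' = \<rho>"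
        by (auto simp: shared_simplices_def)
      \<comment> \<open>The facet \<open>\<rho> - {v}\<close> has no partner in \<open>S\<close> but
        has one after the insertion; that partner can only be \<open>\<sigma>\<close>.\<close>
      then have "\<rho> - {v} \<subseteq> \<sigma>"
        using \<rho> by (auto simp: shared_simplices_def)
      moreover have "card (\<rho> - {v}) = d"
        using v(1) dsimplicesD[of \<rho> n d] \<open>\<rho> \<in> S\<close> assms(1) by auto
      ultimately have "\<rho> - {v} \<in> ?F" "\<rho> \<in> ?U (\<rho> - {v})"
        using v \<open>\<rho> \<in> S\<close> by auto
      then show ?thesis by blast
    qed auto
  qed
  have "card (?U \<tau>) \<le> 1" for \<tau>
    using card_le_Suc0_iff_eq[of "?U \<tau>"] finS by auto
  then have "(\<Sum>\<tau>\<in>?F. card (?U \<tau>)) \<le> d + 1"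
    using sum_bounded_above[of ?F "\<lambda>\<tau>. card (?U \<tau>)" 1] F by simp
  then have "card (\<Union>\<tau>\<in>?F. ?U \<tau>) \<le> d + 1"
    using card_UN_le[OF F(1), of ?U] by linarith
  moreover have finU: "finite (\<Union>\<tau>\<in>?F. ?U \<tau>)"
    using F finS by auto
  ultimately have "card (insert \<sigma> (\<Union>\<tau>\<in>?F. ?U \<tau>)) \<le> d + 2"
    by (auto simp: card_insert_if)
  moreover have "card (shared_simplices (insert \<sigma> S)) \<le>
      card (shared_simplices S \<union> insert \<sigma> (\<Union>\<tau>\<in>?F. ?U \<tau>))"
    using finU finite_shared_simplices[OF finS] by (intro card_mono s2) auto
  ultimately have "card (shared_simplices (insert \<sigma> S)) \<le> card (shared_simplices S) + (d + 2)"
    using card_Un_le[of "shared_simplices S" "insert \<sigma> (\<Union>\<tau>\<in>?F. ?U \<tau>)"] by linarith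
  moreover have "card (shared_simplices S) \<le> card (shared_simplices (insert \<sigma> S))"
    using s1 finS by (intro card_mono finite_shared_simplices) auto
  moreover have "card (shared_ridges n d S) \<le> card (shared_ridges n d (insert \<sigma> S))"
    using r1 by (intro card_mono) auto
  moreover have "card (shared_ridges n d (insert \<sigma> S)) \<le> card (shared_ridges n d S) + (d + 1)"
  proof -
    have "card (shared_ridges n d (insert \<sigma> S)) \<le> card (shared_ridges n d S \<union> ?F)"
      using F by (intro card_mono r2) auto
    then show ?thesis
      using card_Un_le[of "shared_ridges n d S" ?F] F by linarith
  qed
  \<comment> \<open>Both counts can only grow, by at most \<open>d + 2\<close> and
    \<open>d + 1\<close> respectively, so their difference moves by at most the larger
    bound.\<close>
  ultimately show ?thesis
    by (simp add: excess_def)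
qed

section \<open>Expected numbers of shared simplices and shared ridges\<close>

definition cofaces :: "nat \<Rightarrow> nat \<Rightarrow> nat set \<Rightarrow> nat set set" where
  "cofaces n d \<tau> = {\<sigma> \<in> dsimplices n d. \<tau> \<subseteq> \<sigma>}"

lemma finite_cofaces [simp]: "finite (cofaces n d \<tau>)"
  by (simp add: cofaces_def)

lemma card_cofaces:
  assumes "\<tau> \<subseteq> {..<n}" "card \<tau> = d"
  shows "card (cofaces n d \<tau>) = n - d"
proof -
  have fin: "finite \<tau>" using assms finite_subset by auto
  have "cofaces n d \<tau> = (\<lambda>v. insert v \<tau>) ` ({..<n} - \<tau>)"
  proof (intro equalityI subsetI)
    fix \<sigma> assume "\<sigma> \<in> cofaces n d \<tau>"
    then have \<sigma>: "\<sigma> \<in> dsimplices n d" "\<tau> \<subseteq> \<sigma>" by (auto simp: cofaces_def)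
    then have "card (\<sigma> - \<tau>) = 1"
      using dsimplicesD[OF \<sigma>(1)] fin assms by (simp add: card_Diff_subset)
    then obtain v where "\<sigma> - \<tau> = {v}" by (rule card_1_singletonE)
    then show "\<sigma> \<in> (\<lambda>v. insert v \<tau>) ` ({..<n} - \<tau>)"
      using \<sigma> dsimplicesD[OF \<sigma>(1)] by (intro image_eqI[of _ _ v]) auto
  qed (use assms fin in \<open>auto simp: cofaces_def dsimplices_def\<close>)
  moreover have "inj_on (\<lambda>v. insert v \<tau>) ({..<n} - \<tau>)"
    by (auto simp: inj_on_def)
  ultimately show ?thesis
    using assms fin by (simp add: card_image card_Diff_subset)
qed

text \<open>A simplex is shared when it is drawn and each of its \<open>d + 1\<close> facets has a
  drawn coface among the \<open>n - d - 1\<close> others. These families of other cofaces are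
  disjoint for different facets, so the probabilities multiply.\<close>

lemma mean_card_shared_simplices:
  fixes p :: real
  shows "bernoulli_mean p (dsimplices n d) (\<lambda>S. real (card (shared_simplices S))) =
    (n choose Suc d) * (p * (1 - (1 - p) ^ (n - d - 1)) ^ (d + 1))"
proof -
  let ?D = "dsimplices n d"
  have one: "bernoulli_mean p ?D (\<lambda>S. of_bool (\<sigma> \<in> shared_simplices S)) =
      p * (1 - (1 - p) ^ (n - d - 1)) ^ (d + 1)" if \<sigma>: "\<sigma> \<in> ?D" for \<sigma>
  proof -
    note \<sigma>' = dsimplicesD[OF \<sigma>]
    define B where "B v = cofaces n d (\<sigma> - {v}) - {\<sigma>}" for v
    have cB: "card (B v) = n - d - 1" if "v \<in> \<sigma>" for v
    proof -
      have "\<sigma> \<in> cofaces n d (\<sigma> - {v})" using \<sigma> by (auto simp: cofaces_def)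
      moreover have "card (cofaces n d (\<sigma> - {v})) = n - d"
        using \<sigma>' that by (intro card_cofaces) auto
      ultimately show ?thesis by (simp add: B_def)
    qed
    have disj: "disjoint_family_on B \<sigma>"
    proof -
      have False if "v \<in> \<sigma>" "w \<in> \<sigma>" "v \<noteq> w" "\<rho> \<in> B v" "\<rho> \<in> B w" for v w \<rho>
      proof -
        \<comment> \<open>Two distinct facets of \<open>\<sigma>\<close> have union
          \<open>\<sigma>\<close>, so a simplex containing both contains \<open>\<sigma>\<close> and
          equals it by cardinality.\<close>
        have "\<rho> \<in> ?D" "\<rho> \<noteq> \<sigma>" "\<sigma> \<subseteq> \<rho>"
          using that by (auto simp: B_def cofaces_def)
        then show False
          using dsimplicesD[of \<rho> n d] \<sigma>' card_subset_eq[of \<rho> \<sigma>] by auto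
      qed
      then show ?thesis unfolding disjoint_family_on_def by blast
    qed
    \<comment> \<open>The event splits into one about \<open>\<sigma>\<close> alone and one about
      the other simplices, which are independent.\<close>
    have "bernoulli_mean p ?D (\<lambda>S. of_bool (\<sigma> \<in> shared_simplices S)) =
        bernoulli_mean p ?D (\<lambda>S. of_bool (\<sigma> \<in> S \<inter> {\<sigma>}) *
          of_bool (\<forall>v\<in>\<sigma>. S \<inter> (- {\<sigma>}) \<inter> B v \<noteq> {}))"
      by (intro bernoulli_mean_cong) (auto simp: shared_simplices_def B_def cofaces_def of_bool_def)
    also have "\<dots> = bernoulli_mean p ?D (\<lambda>S. of_bool (\<sigma> \<in> S \<inter> {\<sigma>})) *
          bernoulli_mean p ?D (\<lambda>S. of_bool (\<forall>v\<in>\<sigma>. S \<inter> (- {\<sigma>}) \<inter> B v \<noteq> {}))"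
      by (rule bernoulli_mean_indep[where f = "\<lambda>X. of_bool (\<sigma> \<in> X)"
            and g = "\<lambda>X. of_bool (\<forall>v\<in>\<sigma>. X \<inter> B v \<noteq> {})"]) auto
    also have "bernoulli_mean p ?D (\<lambda>S. of_bool (\<sigma> \<in> S \<inter> {\<sigma>})) = p"
      using bernoulli_mean_member[OF _ \<sigma>] by simp
    also have "(\<lambda>S. of_bool (\<forall>v\<in>\<sigma>. S \<inter> (- {\<sigma>}) \<inter> B v \<noteq> {}) :: real) =
        (\<lambda>S. of_bool (\<forall>v\<in>\<sigma>. S \<inter> B v \<noteq> {}))"
    proof -
      have "S \<inter> (- {\<sigma>}) \<inter> B v = S \<inter> B v" for S v by (auto simp: B_def)
      then show ?thesis by simp
    qed
    also have "bernoulli_mean p ?D (\<lambda>S. of_bool (\<forall>v\<in>\<sigma>. S \<inter> B v \<noteq> {})) =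
        (\<Prod>v\<in>\<sigma>. 1 - (1 - p) ^ card (B v))"
      by (intro bernoulli_mean_hit_all disj \<sigma>'(3)) (auto simp: B_def cofaces_def)
    also have "\<dots> = (1 - (1 - p) ^ (n - d - 1)) ^ (d + 1)"
      using cB \<sigma>' by simp
    finally show ?thesis .
  qed
  have "bernoulli_mean p ?D (\<lambda>S. real (card (shared_simplices S))) =
      bernoulli_mean p ?D (\<lambda>S. \<Sum>\<sigma>\<in>?D. of_bool (\<sigma> \<in> shared_simplices S))"
  proof (rule bernoulli_mean_cong)
    fix S assume "S \<subseteq> ?D"
    then have "?D \<inter> {\<sigma>. \<sigma> \<in> shared_simplices S} = shared_simplices S"
      by (auto simp: shared_simplices_def)
    then show "real (card (shared_simplices S)) = (\<Sum>\<sigma>\<in>?D. of_bool (\<sigma> \<in> shared_simplices S))"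
      by (simp add: sum_of_bool_eq)
  qed
  then show ?thesis
    by (simp add: bernoulli_mean_sum one card_dsimplices del: sum_of_bool_eq)
qed

text \<open>The degree of a fixed ridge is binomial with \<open>n - d\<close> trials; the
  probabilities of degree 0 and of degree 1 are subtracted from 1.\<close>

lemma mean_card_shared_ridges:
  fixes p :: real
  shows "bernoulli_mean p (dsimplices n d) (\<lambda>S. real (card (shared_ridges n d S))) =
    (n choose d) * (1 - (1 - p) ^ (n - d) - real (n - d) * (p * (1 - p) ^ (n - d - 1)))"
proof -
  let ?D = "dsimplices n d"
  let ?F = "{\<tau>. \<tau> \<subseteq> {..<n} \<and> card \<tau> = d}"
  have F: "finite ?F" "card ?F = n choose d"
    using n_subsets[of "{..<n}" d] by auto
  have one: "bernoulli_mean p ?D (\<lambda>S. of_bool (\<tau> \<in> shared_ridges n d S)) =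
      1 - (1 - p) ^ (n - d) - real (n - d) * (p * (1 - p) ^ (n - d - 1))" if \<tau>: "\<tau> \<in> ?F" for \<tau>
  proof -
    define B where "B = cofaces n d \<tau>"
    have B: "finite B" "B \<subseteq> ?D" "card B = n - d"
      using \<tau> card_cofaces[of \<tau> n d] by (auto simp: B_def cofaces_def)
    have pair: "bernoulli_mean p ?D (\<lambda>S. of_bool (\<sigma> \<in> S) * of_bool (S \<inter> (B - {\<sigma>}) = {})) =
        p * (1 - p) ^ (n - d - 1)" if "\<sigma> \<in> B" for \<sigma>
    proof -
      have "bernoulli_mean p ?D (\<lambda>S. of_bool (\<sigma> \<in> S) * of_bool (S \<inter> (B - {\<sigma>}) = {})) =
         bernoulli_mean p ?D (\<lambda>S. of_bool (\<sigma> \<in> S)) *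
         bernoulli_mean p ?D (\<lambda>S. of_bool (S \<inter> (B - {\<sigma>}) = {}))"
        using bernoulli_mean_indep[of ?D "{\<sigma>}" "B - {\<sigma>}" p "\<lambda>X. of_bool (\<sigma> \<in> X)"
            "\<lambda>X. of_bool (X = {})"] by simp
      then show ?thesis
        using that B bernoulli_mean_member[of ?D \<sigma> p] bernoulli_mean_avoid[of ?D "B - {\<sigma>}" p]
        by (simp add: subset_iff)
    qed
    \<comment> \<open>The summand at \<open>\<sigma>\<close> indicates that \<open>\<sigma>\<close>
      is the only drawn coface; at most one summand is nonzero, so the sum indicates degree exactly
      1.\<close>
    have "bernoulli_mean p ?D (\<lambda>S. of_bool (\<tau> \<in> shared_ridges n d S)) =
       bernoulli_mean p ?D (\<lambda>S. 1 - of_bool (S \<inter> B = {}) -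
         (\<Sum>\<sigma>\<in>B. of_bool (\<sigma> \<in> S) * of_bool (S \<inter> (B - {\<sigma>}) = {})))"
    proof (rule bernoulli_mean_cong)
      fix S assume S: "S \<subseteq> ?D"
      have mem: "\<tau> \<in> shared_ridges n d S \<longleftrightarrow> (\<exists>\<sigma>\<in>S \<inter> B. \<exists>\<rho>\<in>S \<inter> B. \<rho> \<noteq> \<sigma>)"
        using \<tau> S unfolding shared_ridges_def B_def cofaces_def by blast
      consider "S \<inter> B = {}" | \<sigma> where "\<sigma> \<in> S \<inter> B" "\<forall>\<rho>\<in>S \<inter> B. \<rho> = \<sigma>" | "\<exists>\<sigma>\<in>S \<inter> B. \<exists>\<rho>\<in>S \<inter> B. \<rho> \<noteq> \<sigma>"
        by blast
      then show "of_bool (\<tau> \<in> shared_ridges n d S) = 1 - of_bool (S \<inter> B = {}) -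
         (\<Sum>\<sigma>\<in>B. of_bool (\<sigma> \<in> S) * of_bool (S \<inter> (B - {\<sigma>}) = {}) :: real)"
      proof cases
        case 1
        then have "(\<Sum>\<sigma>\<in>B. of_bool (\<sigma> \<in> S) * of_bool (S \<inter> (B - {\<sigma>}) = {}) :: real) = 0"
          by (intro sum.neutral) auto
        with 1 mem show ?thesis by simp
      next
        case (2 \<sigma>)
        then have 2: "S \<inter> B = {\<sigma>}" by blast
        then have "(\<Sum>\<rho>\<in>B. of_bool (\<rho> \<in> S) * of_bool (S \<inter> (B - {\<rho>}) = {}) :: real) =
            (\<Sum>\<rho>\<in>B. of_bool (\<rho> = \<sigma>))"
          by (intro sum.cong) (auto simp: of_bool_def)
        also have "\<dots> = 1"
          using 2 B(1) by (auto simp: of_bool_def)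
        finally show ?thesis
          using 2 mem by simp
      next
        case 3
        then have "(\<Sum>\<sigma>\<in>B. of_bool (\<sigma> \<in> S) * of_bool (S \<inter> (B - {\<sigma>}) = {}) :: real) = 0"
          by (intro sum.neutral) (auto simp: of_bool_def)
        moreover have "S \<inter> B \<noteq> {}" using 3 by blast
        ultimately show ?thesis using 3 mem by simp
      qed
    qed
    then show ?thesis
      using B pair bernoulli_mean_avoid[of ?D B p]
      by (simp add: bernoulli_mean_diff bernoulli_mean_const bernoulli_mean_sum
          del: sum_of_bool_mult_eq sum_mult_of_bool_eq)
  qed
  have "bernoulli_mean p ?D (\<lambda>S. real (card (shared_ridges n d S))) =
      bernoulli_mean p ?D (\<lambda>S. \<Sum>\<tau>\<in>?F. of_bool (\<tau> \<in> shared_ridges n d S))"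
  proof (rule bernoulli_mean_cong)
    fix S
    have "?F \<inter> {\<tau>. \<tau> \<in> shared_ridges n d S} = shared_ridges n d S"
      by (auto simp: shared_ridges_def)
    then show "real (card (shared_ridges n d S)) = (\<Sum>\<tau>\<in>?F. of_bool (\<tau> \<in> shared_ridges n d S))"
      using F(1) by (simp add: sum_of_bool_eq)
  qed
  then show ?thesis
    using F by (simp add: bernoulli_mean_sum one del: sum_of_bool_eq)
qed

section \<open>Asymptotics\<close>

lemma prob_Yd_eq_mean:
  "prob_Yd n d p P = bernoulli_mean p (dsimplices n d) (\<lambda>S. of_bool (P (Ycomplex n d S)))"
proof -
  have "{S. S \<subseteq> dsimplices n d \<and> P (Ycomplex n d S)} =
      Pow (dsimplices n d) \<inter> {S. P (Ycomplex n d S)}"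
    by auto
  then show ?thesis
    by (simp add: prob_Yd_def bernoulli_mean_def sum.inter_restrict of_bool_def if_distrib cong: if_cong)
qed

text \<open>Induction on \<open>k\<close> through
  \<open>Suc k * (n choose Suc k) = (n - k) * (n choose k)\<close>: each step contributes a factor
  tending to \<open>1 / Suc k\<close>.\<close>

lemma tendsto_binomial_over_power:
  "(\<lambda>n. real (n choose k) / real n ^ k) \<longlonglongrightarrow> 1 / fact k"
proof (induction k)
  case (Suc k)
  have lim: "(\<lambda>n. 1 - real k / real n) \<longlonglongrightarrow> 1 - 0"
    by (intro tendsto_intros lim_const_over_n)
  have "(\<lambda>n. real (n choose k) / real n ^ k * ((1 - real k / real n) / Suc k)) \<longlonglongrightarrow>
      1 / fact k * ((1 - 0) / Suc k)"
    by (rule tendsto_mult[OF Suc.IH tendsto_divide[OF lim tendsto_const]]) simp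
  then have "(\<lambda>n. real (n choose k) / real n ^ k * ((1 - real k / real n) / Suc k)) \<longlonglongrightarrow> 1 / fact (Suc k)"
    by (simp add: mult.commute)
  moreover have "\<forall>\<^sub>F n in sequentially. real (n choose k) / real n ^ k * ((1 - real k / real n) / Suc k) =
      real (n choose Suc k) / real n ^ Suc k"
    using eventually_gt_at_top[of k]
  proof eventually_elim
    case (elim n)
    have "Suc k * (n choose Suc k) = (n - k) * (n choose k)"
      using binomial_absorption[of k n] binomial_absorb_comp[of n k] by simp
    then have *: "real (Suc k) * real (n choose Suc k) = (real n - real k) * real (n choose k)"
      using elim by (metis of_nat_diff of_nat_mult less_imp_le)
    have "real (n choose k) / real n ^ k * ((1 - real k / real n) / Suc k) =
       (real n - real k) * real (n choose k) / (real (Suc k) * real n ^ Suc k)"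
      using elim by (simp add: divide_simps)
    also have "\<dots> = real (n choose Suc k) / real n ^ Suc k"
      unfolding *[symmetric] by simp
    finally show ?case .
  qed
  ultimately show ?case
    by (rule Lim_transform_eventually)
qed simp

text \<open>The power is the full \<open>n\<close>-th power divided by a fixed power whose base
  tends to 1; the division is legitimate once the base is positive and
  \<open>n \<ge> k\<close>.\<close>

lemma tendsto_one_minus_over_n_power:
  "(\<lambda>n. (1 - c / real n) ^ (n - k)) \<longlonglongrightarrow> exp (- c)"
proof -
  have 1: "(\<lambda>n. 1 - c / real n) \<longlonglongrightarrow> 1 - 0"
    by (intro tendsto_intros lim_const_over_n)
  have "(\<lambda>n. (1 + (- c) / real n) ^ n / (1 - c / real n) ^ k) \<longlonglongrightarrow> exp (- c) / (1 - 0) ^ k"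
    by (intro tendsto_divide tendsto_exp_limit_sequentially tendsto_power 1) auto
  then have "(\<lambda>n. (1 - c / real n) ^ n / (1 - c / real n) ^ k) \<longlonglongrightarrow> exp (- c)"
    by simp
  moreover have "\<forall>\<^sub>F n in sequentially. 1 - c / real n > 0"
    using order_tendstoD(1)[OF 1, of 0] by simp
  then have "\<forall>\<^sub>F n in sequentially. (1 - c / real n) ^ n / (1 - c / real n) ^ k = (1 - c / real n) ^ (n - k)"
    using eventually_ge_at_top[of k] by eventually_elim (subst power_diff, auto)
  ultimately show ?thesis
    by (rule Lim_transform_eventually)
qed

text \<open>This is where \<open>g_fun\<close> comes from. The normalized counts tend to
  \<open>c * (1 - exp (- c)) ^ (d + 1) / fact (d + 1)\<close> and
  \<open>(1 - exp (- c) - c * exp (- c)) / fact d\<close>; over the common denominator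
  \<open>fact (d + 1)\<close> their difference has numerator
  \<open>g_fun d c - (d + 1)\<close>.\<close>

lemma mean_excess_asymptotics:
  "(\<lambda>n. bernoulli_mean (c / real n) (dsimplices n d) (excess n d) / real n ^ d)
    \<longlonglongrightarrow> (g_fun d c - (d + 1)) / fact (Suc d)"
proof -
  define p where "p n = c / real n" for n
  define A where "A k n = real (n choose k) / real n ^ k" for k n
  have A: "A k \<longlonglongrightarrow> 1 / fact k" for k
    using tendsto_binomial_over_power by (simp add: A_def[abs_def])
  have pw: "(\<lambda>n. (1 - p n) ^ (n - k)) \<longlonglongrightarrow> exp (- c)" for k
    using tendsto_one_minus_over_n_power by (simp add: p_def)
  have r: "(\<lambda>n. 1 - real d / real n) \<longlonglongrightarrow> 1 - 0"
    by (intro tendsto_intros lim_const_over_n)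
  have "(\<lambda>n. A (Suc d) n * (c * (1 - (1 - p n) ^ (n - (d + 1))) ^ (d + 1)) -
      A d n * (1 - (1 - p n) ^ (n - d) - c * (1 - real d / real n) * (1 - p n) ^ (n - (d + 1))))
    \<longlonglongrightarrow> 1 / fact (Suc d) * (c * (1 - exp (- c)) ^ (d + 1)) -
      1 / fact d * (1 - exp (- c) - c * (1 - 0) * exp (- c))"
    by (intro tendsto_intros A pw r)
  also have "1 / fact (Suc d) * (c * (1 - exp (- c)) ^ (d + 1)) -
      1 / fact d * (1 - exp (- c) - c * (1 - 0) * exp (- c)) =
    (g_fun d c - (d + 1)) / fact (Suc d)"
  proof -
    have "1 / fact d = real (d + 1) / fact (Suc d)"
      by (simp add: divide_simps)
    then show ?thesis
      by (simp add: g_fun_def diff_divide_distrib[symmetric] del: fact_Suc power_Suc) (simp add: algebra_simps)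
  qed
  finally show ?thesis
  proof (rule Lim_transform_eventually)
    show "\<forall>\<^sub>F n in sequentially.
      A (Suc d) n * (c * (1 - (1 - p n) ^ (n - (d + 1))) ^ (d + 1)) -
      A d n * (1 - (1 - p n) ^ (n - d) - c * (1 - real d / real n) * (1 - p n) ^ (n - (d + 1))) =
      bernoulli_mean (c / real n) (dsimplices n d) (excess n d) / real n ^ d"
      \<comment> \<open>For \<open>n > d\<close> one may divide by \<open>n\<close>, and
        \<open>real (n - d)\<close> is the true difference.\<close>
      using eventually_gt_at_top[of d]
    proof eventually_elim
      case (elim n)
      have "A (Suc d) n * c = real (n choose Suc d) * p n / real n ^ d"
        using elim by (simp add: A_def p_def)
      moreover have "c * (1 - real d / real n) = real (n - d) * p n"
        using elim by (simp add: p_def field_simps of_nat_diff)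
      moreover have "bernoulli_mean (p n) (dsimplices n d) (excess n d) =
          real (n choose Suc d) * (p n * (1 - (1 - p n) ^ (n - d - 1)) ^ (d + 1)) -
          real (n choose d) * (1 - (1 - p n) ^ (n - d) - real (n - d) * (p n * (1 - p n) ^ (n - d - 1)))"
        unfolding excess_def[abs_def] bernoulli_mean_diff mean_card_shared_simplices
          mean_card_shared_ridges ..
      ultimately show ?case
        unfolding p_def[symmetric] A_def mult.assoc[symmetric] by (simp add: diff_divide_distrib)
    qed
  qed
qed

theorem theorem2:
  fixes d :: nat and c :: real
  assumes "d \<ge> 2" and "c > c_thr d"
  shows "(\<lambda>n. prob_Yd n d (c / real n)
            (\<lambda>Y. homology_nonzero TYPE('a::field) Y d)) \<longlonglongrightarrow> 1"
proof -
  note c = above_c_thr[OF assms]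
  define p where "p n = c / real n" for n
  define m where "m n = bernoulli_mean (p n) (dsimplices n d) (excess n d)" for n
  define L where "L = (g_fun d c - (d + 1)) / fact (Suc d)"
  \<comment> \<open>The bound of \<open>bernoulli_variance_le\<close> with increment bound
    \<open>K = d + 2\<close>.\<close>
  define V where "V n = real (card (dsimplices n d)) * (p n * (1 - p n) * real (d + 2) ^ 2)" for n
  have L: "L > 0"
    using c by (simp add: L_def)
  have m: "(\<lambda>n. m n / real n ^ d) \<longlonglongrightarrow> L"
    using mean_excess_asymptotics by (simp add: m_def p_def L_def)
  have p0: "p \<longlonglongrightarrow> 0"
    using lim_const_over_n by (simp add: p_def[abs_def])
  \<comment> \<open>This is \<open>1 - V n / (m n)^2\<close> with every factor scaled to converge;
    the leftover \<open>(1 / real n) ^ d\<close> tends to 0 since \<open>d\<close> is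
    positive.\<close>
  have "(\<lambda>n. 1 - real (n choose Suc d) / real n ^ Suc d * c * (1 - p n) * real (d + 2) ^ 2
      / (m n / real n ^ d) ^ 2 * (1 / real n) ^ d) \<longlonglongrightarrow>
      1 - 1 / fact (Suc d) * c * (1 - 0) * real (d + 2) ^ 2 / L ^ 2 * 0 ^ d"
    using L by (intro tendsto_intros tendsto_binomial_over_power p0 m lim_1_over_n) auto
  then have "(\<lambda>n. 1 - real (n choose Suc d) / real n ^ Suc d * c * (1 - p n) * real (d + 2) ^ 2
      / (m n / real n ^ d) ^ 2 * (1 / real n) ^ d) \<longlonglongrightarrow> 1"
    using assms(1) by (simp add: power_0_left)
  \<comment> \<open>The identity covers \<open>m n = 0\<close> too, where both quotients are
    0.\<close>
  moreover have "\<forall>\<^sub>F n in sequentially.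
     1 - real (n choose Suc d) / real n ^ Suc d * c * (1 - p n) * real (d + 2) ^ 2
      / (m n / real n ^ d) ^ 2 * (1 / real n) ^ d = 1 - V n / (m n)\<^sup>2"
    using eventually_gt_at_top[of 0]
  proof eventually_elim
    case (elim n)
    define N where "N = real n ^ d"
    have N: "N > 0" "real n ^ Suc d = real n * N" "(1 / real n) ^ d = 1 / N"
      using elim by (simp_all add: N_def power_one_over)
    have "c = p n * real n"
      using elim by (simp add: p_def)
    then show ?case
      using elim N(1) unfolding V_def card_dsimplices N N_def[symmetric]
      by (simp add: divide_simps) (simp add: power2_eq_square algebra_simps)
  qed
  ultimately have low: "(\<lambda>n. 1 - V n / (m n)\<^sup>2) \<longlonglongrightarrow> 1"
    by (rule Lim_transform_eventually)
  \<comment> \<open>A positive limit makes the mean positive for large \<open>n\<close>, as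
    Chebyshev requires; \<open>p n < 1\<close> makes the weights nonnegative.\<close>
  have "\<forall>\<^sub>F n in sequentially. m n / real n ^ d > 0"
    by (rule order_tendstoD(1)[OF m L])
  moreover have "\<forall>\<^sub>F n in sequentially. p n < 1"
    by (rule order_tendstoD(2)[OF p0]) simp
  ultimately have bounds: "\<forall>\<^sub>F n in sequentially.
      1 - V n / (m n)\<^sup>2 \<le> prob_Yd n d (p n) (\<lambda>Y. homology_nonzero TYPE('a) Y d) \<and>
      prob_Yd n d (p n) (\<lambda>Y. homology_nonzero TYPE('a) Y d) \<le> 1"
  proof eventually_elim
    case (elim n)
    let ?D = "dsimplices n d"
    have p: "0 \<le> p n" "p n \<le> 1"
      using elim c by (auto simp: p_def)
    have m0: "m n > 0"
      using elim(1) by (simp add: zero_less_divide_iff not_less zero_le_power)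
    have "bernoulli_mean (p n) ?D (\<lambda>S. (excess n d S)\<^sup>2) - (m n)\<^sup>2 \<le> V n"
      unfolding m_def V_def using p excess_insert_diff_le[of _ n d]
      by (intro bernoulli_variance_le) auto
    then have "1 - V n / (m n)\<^sup>2 \<le>
        1 - (bernoulli_mean (p n) ?D (\<lambda>S. (excess n d S)\<^sup>2) - (m n)\<^sup>2) / (m n)\<^sup>2"
      by (intro diff_left_mono divide_right_mono) auto
    also have "\<dots> \<le> bernoulli_mean (p n) ?D (\<lambda>S. of_bool (excess n d S > 0))"
      using bernoulli_chebyshev[OF _ p, of ?D "excess n d"] m0 by (simp add: m_def)
    also have "\<dots> \<le> prob_Yd n d (p n) (\<lambda>Y. homology_nonzero TYPE('a) Y d)"
      unfolding prob_Yd_eq_mean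
    proof (rule bernoulli_mean_mono[OF p])
      fix S assume "S \<subseteq> ?D"
      then show "(of_bool (excess n d S > 0) :: real) \<le>
          of_bool (homology_nonzero TYPE('a) (Ycomplex n d S) d)"
        using homology_nonzero_if_card_less[of S n d, where 'a = 'a] by (auto simp: excess_def)
    qed
    finally have "1 - V n / (m n)\<^sup>2 \<le> prob_Yd n d (p n) (\<lambda>Y. homology_nonzero TYPE('a) Y d)" .
    moreover have "prob_Yd n d (p n) (\<lambda>Y. homology_nonzero TYPE('a) Y d) \<le>
        bernoulli_mean (p n) ?D (\<lambda>_. 1)"
      unfolding prob_Yd_eq_mean by (rule bernoulli_mean_mono[OF p]) auto
    ultimately show ?case
      by (simp add: bernoulli_mean_const)
  qed
  have "(\<lambda>n. prob_Yd n d (p n) (\<lambda>Y. homology_nonzero TYPE('a) Y d)) \<longlonglongrightarrow> 1"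
    using bounds by (intro tendsto_sandwich[OF _ _ low tendsto_const]) (auto elim: eventually_mono)
  then show ?thesis
    by (simp add: p_def)
qed

end
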